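(* Let $g$ be an integer greater than nine, and let $\mathcal{S}(4,g)$ be the set of numerical semigroups with multiplicity four and genus $g$. Then $\#\mathcal{S}(4,g)=\left\lfloor\frac g4\right\rfloor^2-\frac32\left\lfloor\frac g3\right\rfloor^2+\left\lfloor\frac{g+1}{5}\right\rfloor^2-\frac32\left\lfloor\frac{g+1}{3}\right\rfloor^2-\frac32\left\lfloor\frac{g+2}{6}\right\rfloor^2-\left\lfloor\frac{g+2}{5}\right\rfloor^2+\left\lfloor\frac{g+2}{4}\right\rfloor^2-\frac32\left\lfloor\frac{g+2}{3}\right\rfloor^2-\frac32\left\lfloor\frac{g+5}{6}\right\rfloor^2+\left\lfloor\frac{2g+1}{5}\right\rfloor^2-\left\lfloor\frac{2g+4}{5}\right\rfloor^2+\left(g-\frac32\right)\left\lfloor\frac g3\right\rfloor-\left\lfloor\frac g5\right\rfloor\left\lfloor\frac{2g}{5}\right\rfloor+\left\lfloor\frac g4\right\rfloor\left(1-\left\lfloor\frac g2\right\rfloor\right)+\left(\frac14+\frac g2\right)\left\lfloor\frac g2\right\rfloor+\left\lfloor\frac{g+1}{5}\right\rfloor+\left(g-\frac12\right)\left\lfloor\frac{g+1}{3}\right\rfloor+\left(\left\lfloor\frac g2\right\rfloor-\frac12\right)\left\lfloor\frac{g+2}{6}\right\rfloor+\left\lfloor\frac{2g}{5}\right\rfloor\left\lfloor\frac{g+2}{5}\right\rfloor-\left\lfloor\frac g2\right\rfloor\left\lfloor\frac{g+2}{4}\right\rfloor+\left(g+\frac12\right)\left\lfloor\frac{g+2}{3}\right\rfloor+\left(-\left\lfloor\frac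 g2\right\rfloor+g+\frac12\right)\left\lfloor\frac{g+5}{6}\right\rfloor+\left(\left\lfloor\frac g5\right\rfloor-g+1\right)\left\lfloor\frac{2g+1}{5}\right\rfloor+\left(-\left\lfloor\frac{g+1}{5}\right\rfloor+g+1\right)\left\lfloor\frac{2g+4}{5}\right\rfloor-\frac{5g^2}{8}-\frac{3g}{8}$.
   Context: A numerical semigroup is a submonoid $S$ of $(\mathbb{N},+)$ with $\mathbb{N}\setminus S$ finite. Its multiplicity is its least positive element and its genus is $\#(\mathbb{N}\setminus S)$. $\lfloor\cdot\rfloor$ is the floor function. *)

theory Defs
  imports Complex_Main
begin

definition numerical_semigroup :: "nat set \<Rightarrow> bool" where
  "numerical_semigroup S \<longleftrightarrow>
     0 \<in> S \<and> (\<forall>x\<in>S. \<forall>y\<in>S. x + y \<in> S) \<and> finite (UNIV - S)"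

definition multiplicity :: "nat set \<Rightarrow> nat" where
  "multiplicity S = (LEAST x. x \<in> S \<and> 0 < x)"

definition genus :: "nat set \<Rightarrow> nat" where
  "genus S = card (UNIV - S)"

definition numerical_semigroups :: "nat \<Rightarrow> nat \<Rightarrow> nat set set" where
  "numerical_semigroups m g = {S. numerical_semigroup S \<and> multiplicity S = m \<and> genus S = g}"

end

theory Submission
  imports Defs
begin

text \<open>A numerical semigroup \<open>S\<close> of multiplicity \<open>m\<close> is determined by its Kunz coordinates: \<open>k i\<close> is the
  number of gaps congruent to \<open>i\<close> modulo \<open>m\<close>. For \<open>m = 4\<close> and genus \<open>g\<close> this gives the lattice points
  \<open>(a, b, c)\<close> with \<open>a + b + c = g\<close> of a polyhedron. For fixed \<open>b\<close> the admissible \<open>a\<close> form an interval with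
  \<open>min (b + 1) (g + 1 - 2 * b)\<close> elements, and the sum over \<open>b\<close> splits at \<open>g div 3\<close> into two arithmetic
  progressions. In the claimed formula the terms with denominator \<open>5\<close> add up to \<open>g\<close>, and the
  remaining identity is a polynomial identity on each residue class of \<open>g\<close> modulo \<open>12\<close>.\<close>

section \<open>Kunz coordinates for arbitrary multiplicity\<close>

definition kunz_set :: "nat \<Rightarrow> (nat \<Rightarrow> nat) \<Rightarrow> nat set" where
  "kunz_set m k = {n. k (n mod m) \<le> n div m}"

lemma mem_kunz_set: "n \<in> kunz_set m k \<longleftrightarrow> k (n mod m) \<le> n div m"
  by (simp add: kunz_set_def)

lemma mem_kunz_set_residue:
  "i < m \<Longrightarrow> m * q + i \<in> kunz_set m k \<longleftrightarrow> k i \<le> q"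
  by (simp add: mem_kunz_set)

text \<open>Each threshold \<open>k i\<close> can be read off from its residue class, while values
  of \<open>k\<close> from index \<open>m\<close> on are never consulted.\<close>

lemma kunz_set_eq_iff:
  assumes "0 < m"
  shows "kunz_set m k = kunz_set m l \<longleftrightarrow> (\<forall>i<m. k i = l i)"
proof
  assume eq: "kunz_set m k = kunz_set m l"
  show "\<forall>i<m. k i = l i"
  proof (intro allI impI)
    fix i assume i: "i < m"
    have "k i \<le> q \<longleftrightarrow> l i \<le> q" for q
      using eq mem_kunz_set_residue[OF i] by metis
    then show "k i = l i" by (meson order_antisym order_refl)
  qed
next
  assume "\<forall>i<m. k i = l i"
  then show "kunz_set m k = kunz_set m l"
    using assms by (simp add: kunz_set_def)
qed

lemma compl_kunz_set:
  assumes "0 < m"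
  shows "UNIV - kunz_set m k = (\<lambda>(i, q). m * q + i) ` (SIGMA i:{..<m}. {..<k i})"
proof
  show "UNIV - kunz_set m k \<subseteq> (\<lambda>(i, q). m * q + i) ` (SIGMA i:{..<m}. {..<k i})"
  proof
    fix n assume "n \<in> UNIV - kunz_set m k"
    then have "(n mod m, n div m) \<in> (SIGMA i:{..<m}. {..<k i})"
      using assms by (simp add: mem_kunz_set)
    moreover have "n = (\<lambda>(i, q). m * q + i) (n mod m, n div m)"
      by simp
    ultimately show "n \<in> (\<lambda>(i, q). m * q + i) ` (SIGMA i:{..<m}. {..<k i})"
      by (rule rev_image_eqI)
  qed
qed (auto simp: mem_kunz_set_residue)

lemma finite_compl_kunz_set: "0 < m \<Longrightarrow> finite (UNIV - kunz_set m k)"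
  by (simp add: compl_kunz_set)

lemma genus_kunz_set:
  assumes "0 < m"
  shows "genus (kunz_set m k) = (\<Sum>i<m. k i)"
proof -
  have "inj_on (\<lambda>(i, q). m * q + i) (SIGMA i:{..<m}. {..<k i})"
  proof (rule inj_onI, clarsimp)
    fix i q i' q' assume i: "i < m" "i' < m" and eq: "m * q + i = m * q' + i'"
    have "i = i'" using arg_cong[OF eq, of "\<lambda>n. n mod m"] i by simp
    moreover have "q = q'" using arg_cong[OF eq, of "\<lambda>n. n div m"] i by simp
    ultimately show "i = i' \<and> q = q'" by simp
  qed
  then show ?thesis
    unfolding genus_def compl_kunz_set[OF assms] by (simp add: card_image)
qed

text \<open>Closure only has to be tested on the least elements \<open>m * k i + i\<close> of the
  classes; the term \<open>(i + j) div m\<close> is the carry when two residues are added.\<close>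

lemma numerical_semigroup_kunz_set_iff:
  assumes m: "0 < m"
  shows "numerical_semigroup (kunz_set m k) \<longleftrightarrow>
    k 0 = 0 \<and> (\<forall>i<m. \<forall>j<m. k ((i + j) mod m) \<le> k i + k j + (i + j) div m)"
proof -
  have "(\<forall>x\<in>kunz_set m k. \<forall>y\<in>kunz_set m k. x + y \<in> kunz_set m k) \<longleftrightarrow>
    (\<forall>i<m. \<forall>j<m. k ((i + j) mod m) \<le> k i + k j + (i + j) div m)" (is "?L \<longleftrightarrow> ?R")
  proof
    assume L: ?L
    show ?R
    proof (intro allI impI)
      fix i j assume ij: "i < m" "j < m"
      have "(m * k i + i) + (m * k j + j) \<in> kunz_set m k"
        using L ij by (simp add: mem_kunz_set_residue)
      moreover have "(m * k i + i) + (m * k j + j) = m * (k i + k j) + (i + j)"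
        by (simp add: algebra_simps)
      ultimately show "k ((i + j) mod m) \<le> k i + k j + (i + j) div m"
        using m by (simp add: mem_kunz_set)
    qed
  next
    assume R: ?R
    show ?L
    proof (intro ballI)
      fix x y assume xy: "x \<in> kunz_set m k" "y \<in> kunz_set m k"
      have "k ((x mod m + y mod m) mod m) \<le>
          k (x mod m) + k (y mod m) + (x mod m + y mod m) div m"
        using R m by simp
      also have "\<dots> \<le> x div m + y div m + (x mod m + y mod m) div m"
        using xy by (simp add: mem_kunz_set)
      also have "\<dots> = (x + y) div m"
        by (rule div_add1_eq[symmetric])
      finally show "x + y \<in> kunz_set m k"
        by (simp add: mem_kunz_set mod_add_eq)
    qed
  qed
  then show ?thesis
    using finite_compl_kunz_set[OF m] by (simp add: numerical_semigroup_def mem_kunz_set)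
qed

text \<open>A number \<open>i\<close> below \<open>m\<close> has quotient 0, so it is a member
  exactly if \<open>k i = 0\<close>; \<open>k 0 = 0\<close> puts \<open>m\<close> itself into the
  set.\<close>

lemma multiplicity_kunz_set_iff:
  assumes m: "0 < m" and k0: "k 0 = 0"
  shows "multiplicity (kunz_set m k) = m \<longleftrightarrow> (\<forall>i<m. 0 < i \<longrightarrow> 0 < k i)"
proof
  assume mult: "multiplicity (kunz_set m k) = m"
  show "\<forall>i<m. 0 < i \<longrightarrow> 0 < k i"
  proof (intro allI impI)
    fix i assume i: "i < m" "0 < i"
    then have "i \<notin> kunz_set m k"
      using mult not_less_Least[of i "\<lambda>x. x \<in> kunz_set m k \<and> 0 < x"]
      unfolding multiplicity_def by auto
    then show "0 < k i" using i by (simp add: mem_kunz_set)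
  qed
next
  assume pos: "\<forall>i<m. 0 < i \<longrightarrow> 0 < k i"
  show "multiplicity (kunz_set m k) = m"
    unfolding multiplicity_def
  proof (rule Least_equality)
    show "m \<in> kunz_set m k \<and> 0 < m" using m k0 by (simp add: mem_kunz_set)
    show "m \<le> y" if "y \<in> kunz_set m k \<and> 0 < y" for y
      using that pos by (force simp: mem_kunz_set intro: leI)
  qed
qed

lemma numerical_semigroup_multiplicity:
  assumes "numerical_semigroup S"
  shows "multiplicity S \<in> S" "0 < multiplicity S"
proof -
  have "\<exists>x. x \<in> S \<and> 0 < x"
  proof (rule ccontr)
    assume "\<nexists>x. x \<in> S \<and> 0 < x"
    then have "UNIV - {0} \<subseteq> UNIV - S" by auto
    then have "finite (UNIV - {0::nat})"
      using assms finite_subset unfolding numerical_semigroup_def by blast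
    then show False by simp
  qed
  then have "multiplicity S \<in> S \<and> 0 < multiplicity S"
    unfolding multiplicity_def by (rule LeastI_ex)
  then show "multiplicity S \<in> S" "0 < multiplicity S" by auto
qed

text \<open>Adding \<open>m \<in> S\<close> keeps each residue class of \<open>S\<close> closed
  upwards, and no class is empty since that would give infinitely many gaps. So a class is described
  by its least quotient.\<close>

lemma numerical_semigroup_eq_kunz_set:
  assumes S: "numerical_semigroup S" and m: "m \<in> S" "0 < m"
  obtains k where "S = kunz_set m k"
proof -
  define k where "k i = (LEAST q. m * q + i \<in> S)" for i
  have add: "x + y \<in> S" if "x \<in> S" "y \<in> S" for x y
    using S that by (auto simp: numerical_semigroup_def)
  have ex: "\<exists>q. m * q + i \<in> S" for i
  proof (rule ccontr)
    assume "\<nexists>q. m * q + i \<in> S"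
    then have "range (\<lambda>q. m * q + i) \<subseteq> UNIV - S" by auto
    then have "finite (range (\<lambda>q. m * q + i))"
      using S finite_subset unfolding numerical_semigroup_def by blast
    moreover have "inj (\<lambda>q. m * q + i)" using m by (auto intro: injI)
    ultimately show False using finite_imageD by fastforce
  qed
  have up: "m * (q + d) + i \<in> S" if "m * q + i \<in> S" for q d i
  proof (induction d)
    case (Suc d)
    then show ?case using add[OF Suc.IH m(1)] by (simp add: algebra_simps)
  qed (use that in simp)
  have mem: "m * q + i \<in> S \<longleftrightarrow> k i \<le> q" for q i
  proof
    show "k i \<le> q" if "m * q + i \<in> S"
      unfolding k_def using that by (rule Least_le)
    have "m * k i + i \<in> S"
      unfolding k_def using ex by (rule LeastI_ex)
    then show "m * q + i \<in> S" if "k i \<le> q"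
      using up[of "k i" i "q - k i"] that by simp
  qed
  have "n \<in> S \<longleftrightarrow> n \<in> kunz_set m k" for n
    using mem[of "n div m" "n mod m"] unfolding mult_div_mod_eq mem_kunz_set .
  then have "S = kunz_set m k" by blast
  then show ?thesis by (rule that)
qed

text \<open>The right side is an image and not a bijective copy, because \<open>k\<close> is
  arbitrary from index \<open>m\<close> on; counting requires choosing representatives.\<close>

lemma numerical_semigroups_eq_kunz_sets:
  assumes m: "0 < m"
  shows "numerical_semigroups m g = kunz_set m ` {k. k 0 = 0 \<and> (\<forall>i<m. 0 < i \<longrightarrow> 0 < k i) \<and>
    (\<forall>i<m. \<forall>j<m. k ((i + j) mod m) \<le> k i + k j + (i + j) div m) \<and> (\<Sum>i<m. k i) = g}"
    (is "_ = kunz_set m ` ?K")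
proof -
  have mem: "kunz_set m k \<in> numerical_semigroups m g \<longleftrightarrow> k \<in> ?K" for k
    using m numerical_semigroup_kunz_set_iff[OF m, of k] multiplicity_kunz_set_iff[OF m, of k]
    by (auto simp: numerical_semigroups_def genus_kunz_set)
  have ex: "\<exists>k. S = kunz_set m k" if "S \<in> numerical_semigroups m g" for S
  proof -
    have "numerical_semigroup S" "m = multiplicity S"
      using that by (auto simp: numerical_semigroups_def)
    then show ?thesis
      using numerical_semigroup_multiplicity numerical_semigroup_eq_kunz_set by metis
  qed
  show ?thesis
  proof
    show "numerical_semigroups m g \<subseteq> kunz_set m ` ?K"
    proof
      fix S assume S: "S \<in> numerical_semigroups m g"
      then obtain k where k: "S = kunz_set m k" using ex by metis
      from S have "k \<in> ?K" unfolding k by (rule mem[THEN iffD1])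
      then show "S \<in> kunz_set m ` ?K" unfolding k by (rule imageI)
    qed
    show "kunz_set m ` ?K \<subseteq> numerical_semigroups m g"
      by (rule image_subsetI) (rule mem[THEN iffD2])
  qed
qed

section \<open>Counting lattice points for multiplicity four\<close>

text \<open>With \<open>a = k 1\<close>, \<open>b = k 2\<close> and
  \<open>c = k 3 = g - a - b\<close> eliminated, the conditions are, in order, \<open>a > 0\<close>,
  \<open>c > 0\<close>, \<open>b \<le> 2 * a\<close>, \<open>c \<le> a + b\<close>,
  \<open>a \<le> b + c + 1\<close> and \<open>b \<le> 2 * c + 1\<close>.\<close>

definition kunz_slice :: "nat \<Rightarrow> nat \<Rightarrow> nat set" where
  "kunz_slice g b = {a. 0 < a \<and> a + b < g \<and> b \<le> 2 * a \<and> g \<le> 2 * a + 2 * b \<and>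
    2 * a \<le> g + 1 \<and> 2 * a + 3 * b \<le> 2 * g + 1}"

text \<open>Both endpoints of the interval for \<open>a\<close> switch at \<open>3 * b = g\<close>.
  Below it, the bounds involving \<open>g div 2\<close> up to rounding are active and leave
  \<open>b + 1\<close> values; above it, the bounds from \<open>b \<le> 2 * a\<close> and
  \<open>b \<le> 2 * c + 1\<close> leave \<open>g + 1 - 2 * b\<close>.\<close>

lemma card_kunz_slice:
  assumes "4 \<le> g" "0 < b" "b \<le> g div 2"
  shows "card (kunz_slice g b) = min (b + 1) (g + 1 - 2 * b)"
proof -
  define lo where "lo = max ((b + 1) div 2) ((g + 1) div 2 - b)"
  define hi where "hi = min ((g + 1) div 2) ((2 * g + 1 - 3 * b) div 2)"
  have "a \<in> kunz_slice g b \<longleftrightarrow> a \<in> {lo..hi}" for a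
  proof -
    have "(b + 1) div 2 \<le> a \<longleftrightarrow> b \<le> 2 * a" "(g + 1) div 2 - b \<le> a \<longleftrightarrow> g \<le> 2 * a + 2 * b"
      "a \<le> (g + 1) div 2 \<longleftrightarrow> 2 * a \<le> g + 1"
      by presburger+
    \<comment> \<open>The bound \<open>b \<le> g div 2\<close> keeps the natural subtraction from
      truncating.\<close>
    moreover have "a \<le> (2 * g + 1 - 3 * b) div 2 \<longleftrightarrow> 2 * a + 3 * b \<le> 2 * g + 1"
      using assms(3) by presburger
    moreover have "0 < a" if "b \<le> 2 * a" using that assms by linarith
    \<comment> \<open>For \<open>b \<ge> 2\<close> the second bound suffices. For
      \<open>b = 1\<close> it only gives \<open>a + 1 \<le> g\<close>, and strictness comes from
      \<open>2 * a \<le> g + 1\<close> with \<open>g \<ge> 4\<close>.\<close>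
    moreover have "a + b < g" if "2 * a \<le> g + 1" "2 * a + 3 * b \<le> 2 * g + 1"
      using that assms by (cases "b = 1") linarith+
    ultimately show ?thesis by (auto simp: kunz_slice_def lo_def hi_def)
  qed
  then have "kunz_slice g b = {lo..hi}" by blast
  moreover have "hi + 1 - lo = min (b + 1) (g + 1 - 2 * b)"
  proof -
    obtain h where h: "g = 2 * h \<or> g = 2 * h + 1" by (meson oddE evenE)
    obtain c where c: "b = 2 * c \<or> b = 2 * c + 1" by (meson oddE evenE)
    have "(2 * g + 1 - 3 * b) div 2 = g - b - b div 2"
      using assms(3) by linarith
    with h c assms show ?thesis
      unfolding lo_def hi_def by (elim disjE; auto simp: min_def max_def)
  qed
  ultimately show ?thesis by simp
qed

lemma card_numerical_semigroups_4_slices: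
  "card (numerical_semigroups 4 g) = card (SIGMA b:{1..g div 2}. kunz_slice g b)"
proof -
  \<comment> \<open>List lookup supplies the representative; its values beyond index 3 do not affect
    \<open>kunz_set 4\<close>.\<close>
  define F where "F = (\<lambda>(b, a). kunz_set 4 ((!) [0, a, b, g - a - b]))"
  let ?T = "SIGMA b:{1..g div 2}. kunz_slice g b"
  let ?K = "{k. k 0 = 0 \<and> (\<forall>i<4. 0 < i \<longrightarrow> 0 < k i) \<and>
    (\<forall>i<4. \<forall>j<4. k ((i + j) mod 4) \<le> k i + k j + (i + j) div 4) \<and> (\<Sum>i<4. k i) = g}"
  have all4: "(\<forall>i<4. P i) \<longleftrightarrow> P 0 \<and> P 1 \<and> P 2 \<and> P 3" for P :: "nat \<Rightarrow> bool"
    by (auto simp: numeral_eq_Suc less_Suc_eq)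
  have sum4: "(\<Sum>i<4. k i) = k 0 + k 1 + k 2 + k 3" for k :: "nat \<Rightarrow> nat"
    by (simp add: numeral_eq_Suc)
  have K: "k \<in> ?K \<longleftrightarrow> k 0 = 0 \<and> k 3 = g - k 1 - k 2 \<and> (k 2, k 1) \<in> ?T" for k
  proof
    assume "k \<in> ?K"
    then have "k 0 = 0" "0 < k 1" "0 < k 2" "0 < k 3" "k 2 \<le> 2 * k 1" "k 3 \<le> k 1 + k 2"
      "k 1 \<le> k 2 + k 3 + 1" "k 2 \<le> 2 * k 3 + 1" and g: "g = k 1 + k 2 + k 3"
      unfolding mem_Collect_eq all4 sum4 by (simp_all flip: numeral_2_eq_2)
    \<comment> \<open>The range bound \<open>k 2 \<le> g div 2\<close> holds because adding the two
      bounds on \<open>k 2\<close> gives \<open>2 * k 2 \<le> 2 * (k 1 + k 3) + 1\<close>, hence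
      \<open>k 2 \<le> k 1 + k 3\<close> by parity.\<close>
    then show "k 0 = 0 \<and> k 3 = g - k 1 - k 2 \<and> (k 2, k 1) \<in> ?T"
      unfolding kunz_slice_def g by (simp add: less_eq_div_iff_mult_less_eq)
  next
    assume "k 0 = 0 \<and> k 3 = g - k 1 - k 2 \<and> (k 2, k 1) \<in> ?T"
    then have "k 0 = 0" "0 < k 1" "0 < k 2" "0 < k 3" "k 2 \<le> 2 * k 1" "k 3 \<le> k 1 + k 2"
      "k 1 \<le> k 2 + k 3 + 1" "k 2 \<le> 2 * k 3 + 1" "g = k 1 + k 2 + k 3"
      unfolding kunz_slice_def by auto
    then show "k \<in> ?K"
      unfolding mem_Collect_eq all4 sum4 by (simp flip: numeral_2_eq_2)
  qed
  have "inj_on F ?T"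
    by (auto simp: F_def inj_on_def kunz_set_eq_iff all4)
  moreover have "F ` ?T = numerical_semigroups 4 g"
  proof -
    have "F ` ?T \<subseteq> kunz_set 4 ` ?K"
    proof (clarify, unfold F_def prod.case, rule imageI)
      fix b a assume "b \<in> {1..g div 2}" "a \<in> kunz_slice g b"
      then show "(!) [0, a, b, g - a - b] \<in> ?K" unfolding K by simp
    qed
    moreover have "kunz_set 4 ` ?K \<subseteq> F ` ?T"
    proof (rule image_subsetI)
      fix k assume "k \<in> ?K"
      then have k: "k 0 = 0" "k 3 = g - k 1 - k 2" "(k 2, k 1) \<in> ?T"
        unfolding K by auto
      then have "kunz_set 4 k = F (k 2, k 1)"
        by (simp add: F_def kunz_set_eq_iff all4)
      then show "kunz_set 4 k \<in> F ` ?T" using k(3) by (rule image_eqI)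
    qed
    ultimately show ?thesis by (simp add: numerical_semigroups_eq_kunz_sets)
  qed
  ultimately show ?thesis by (metis card_image)
qed

lemma card_numerical_semigroups_4:
  assumes "4 \<le> g"
  shows "real (card (numerical_semigroups 4 g)) =
    real (g div 3) * (real (g div 3) + 3) / 2 +
    (real (g div 2) - real (g div 3)) * (real g - real (g div 2) - real (g div 3))"
proof -
  have lin: "(\<Sum>b=1..n. real b + 1) = real n * (real n + 3) / 2" for n :: nat
    by (induction n) (simp_all add: field_simps)
  \<comment> \<open>Parametrising by the number \<open>d\<close> of terms allows induction; later
    \<open>n = g div 3\<close> and \<open>n + d = g div 2\<close>.\<close>
  have rest: "(\<Sum>b=n+1..n+d. real g + 1 - 2 * real b) = real d * (real g - real (n + d) - real n)" for n d
    by (induction d) (simp_all add: field_simps)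
  have fin: "finite (kunz_slice g b)" for b
    by (rule finite_subset[of _ "{..g}"]) (auto simp: kunz_slice_def)
  have "card (numerical_semigroups 4 g) = (\<Sum>b=1..g div 2. card (kunz_slice g b))"
    unfolding card_numerical_semigroups_4_slices by (rule card_SigmaI) (use fin in auto)
  also have "\<dots> = (\<Sum>b=1..g div 2. min (b + 1) (g + 1 - 2 * b))"
    by (rule sum.cong) (use assms in \<open>auto simp: card_kunz_slice\<close>)
  also have "{1..g div 2} = {1..g div 3} \<union> {g div 3 + 1..g div 2}"
    by auto
  also have "(\<Sum>b\<in>\<dots>. min (b + 1) (g + 1 - 2 * b)) =
      (\<Sum>b=1..g div 3. min (b + 1) (g + 1 - 2 * b)) +
      (\<Sum>b=g div 3 + 1..g div 2. min (b + 1) (g + 1 - 2 * b))"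
    by (rule sum.union_disjoint) auto
  \<comment> \<open>The first argument of \<open>min\<close> is the smaller one exactly when
    \<open>3 * b \<le> g\<close>.\<close>
  also have "(\<Sum>b=1..g div 3. min (b + 1) (g + 1 - 2 * b)) = (\<Sum>b=1..g div 3. b + 1)"
    by (rule sum.cong) auto
  also have "(\<Sum>b=g div 3 + 1..g div 2. min (b + 1) (g + 1 - 2 * b)) =
      (\<Sum>b=g div 3 + 1..g div 2. g + 1 - 2 * b)"
    by (rule sum.cong) auto
  also have "real ((\<Sum>b=1..g div 3. b + 1) + \<dots>) = (\<Sum>b=1..g div 3. real b + 1) +
      (\<Sum>b=g div 3 + 1..g div 2. real g + 1 - 2 * real b)"
  proof -
    have "real (\<Sum>b=g div 3 + 1..g div 2. g + 1 - 2 * b) =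
        (\<Sum>b=g div 3 + 1..g div 2. real g + 1 - 2 * real b)"
      unfolding of_nat_sum by (rule sum.cong) (auto simp: of_nat_diff)
    then show ?thesis by (simp add: add.commute)
  qed
  also have "g div 2 = g div 3 + (g div 2 - g div 3)"
    by simp
  finally show ?thesis
    unfolding lin rest by (simp add: of_nat_diff)
qed

section \<open>Simplifying the floor expressions modulo 5 and modulo 12\<close>

text \<open>Writing \<open>g = 5 * q + r\<close> makes every quotient linear in \<open>q\<close>
  with a constant depending on \<open>r\<close>, leaving five polynomial identities in
  \<open>q\<close>.\<close>

lemma floor_terms_mod_5:
  fixes g :: nat
  shows "real (((g + 1) div 5)^2) - real (((g + 2) div 5)^2) + real (((2 * g + 1) div 5)^2)
    - real (((2 * g + 4) div 5)^2) - real (g div 5) * real (2 * g div 5) + real ((g + 1) div 5)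
    + real (2 * g div 5) * real ((g + 2) div 5)
    + (real (g div 5) - real g + 1) * real ((2 * g + 1) div 5)
    + (- real ((g + 1) div 5) + real g + 1) * real ((2 * g + 4) div 5) = real g"
proof -
  define q r where "q = g div 5" and "r = g mod 5"
  have g: "g = 5 * q + r" and "r < 5" by (simp_all add: q_def r_def)
  have e: "(g + c) div 5 = q + (r + c) div 5" "(2 * g + c) div 5 = 2 * q + (2 * r + c) div 5" for c
    unfolding g by simp_all
  note e' = e[of 0, unfolded add_0_right] e[of 1] e[of 2] e[of 4]
  consider "r = 0" | "r = 1" | "r = 2" | "r = 3" | "r = 4" using \<open>r < 5\<close> by linarith
  then show ?thesis
    unfolding e' unfolding g by cases (simp_all add: algebra_simps power2_eq_square)
qed

text \<open>The remaining denominators 2, 3, 4, 6 have least common multiple 12. The summand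
  \<open>5 * real g / 8\<close> combines \<open>- 3 * real g / 8\<close> from the formula with the
  \<open>real g\<close> contributed by the fifths.\<close>

lemma floor_terms_mod_12:
  fixes g :: nat
  shows "real (g div 4) ^ 2 - 3 / 2 * real (g div 3) ^ 2 - 3 / 2 * real ((g + 1) div 3) ^ 2
    - 3 / 2 * real ((g + 2) div 6) ^ 2 + real ((g + 2) div 4) ^ 2
    - 3 / 2 * real ((g + 2) div 3) ^ 2 - 3 / 2 * real ((g + 5) div 6) ^ 2
    + (real g - 3 / 2) * real (g div 3) + real (g div 4) * (1 - real (g div 2))
    + (1 / 4 + real g / 2) * real (g div 2) + (real g - 1 / 2) * real ((g + 1) div 3)
    + (real (g div 2) - 1 / 2) * real ((g + 2) div 6) - real (g div 2) * real ((g + 2) div 4)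
    + (real g + 1 / 2) * real ((g + 2) div 3)
    + (- real (g div 2) + real g + 1 / 2) * real ((g + 5) div 6)
    - 5 * real g ^ 2 / 8 + 5 * real g / 8 =
    real (g div 3) * (real (g div 3) + 3) / 2 +
    (real (g div 2) - real (g div 3)) * (real g - real (g div 2) - real (g div 3))"
proof -
  define q r where "q = g div 12" and "r = g mod 12"
  have g: "g = 12 * q + r" and "r < 12" by (simp_all add: q_def r_def)
  have e: "(g + c) div 2 = 6 * q + (r + c) div 2" "(g + c) div 3 = 4 * q + (r + c) div 3"
    "(g + c) div 4 = 3 * q + (r + c) div 4" "(g + c) div 6 = 2 * q + (r + c) div 6" for c
    unfolding g by presburger+
  note e' = e[of 0, unfolded add_0_right] e[of 1] e[of 2] e[of 5]
  from \<open>r < 12\<close> have "r = 0 \<or> r = 1 \<or> r = 2 \<or> r = 3 \<or> r = 4 \<or> r = 5 \<or> r = 6 \<or> r = 7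
      \<or> r = 8 \<or> r = 9 \<or> r = 10 \<or> r = 11"
    by presburger
  then show ?thesis
    unfolding e' unfolding g by (elim disjE) (simp_all add: field_simps power2_eq_square)
qed

theorem theorem3p5:
  fixes g :: nat
  assumes "g > 9"
  shows "real (card (numerical_semigroups 4 g)) =
      \<lfloor>real g / 4\<rfloor>^2
    - 3 / 2 * \<lfloor>real g / 3\<rfloor>^2
    + \<lfloor>(real g + 1) / 5\<rfloor>^2
    - 3 / 2 * \<lfloor>(real g + 1) / 3\<rfloor>^2
    - 3 / 2 * \<lfloor>(real g + 2) / 6\<rfloor>^2
    - \<lfloor>(real g + 2) / 5\<rfloor>^2
    + \<lfloor>(real g + 2) / 4\<rfloor>^2
    - 3 / 2 * \<lfloor>(real g + 2) / 3\<rfloor>^2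
    - 3 / 2 * \<lfloor>(real g + 5) / 6\<rfloor>^2
    + \<lfloor>(2 * real g + 1) / 5\<rfloor>^2
    - \<lfloor>(2 * real g + 4) / 5\<rfloor>^2
    + (real g - 3 / 2) * \<lfloor>real g / 3\<rfloor>
    - \<lfloor>real g / 5\<rfloor> * \<lfloor>2 * real g / 5\<rfloor>
    + \<lfloor>real g / 4\<rfloor> * (1 - \<lfloor>real g / 2\<rfloor>)
    + (1 / 4 + real g / 2) * \<lfloor>real g / 2\<rfloor>
    + \<lfloor>(real g + 1) / 5\<rfloor>
    + (real g - 1 / 2) * \<lfloor>(real g + 1) / 3\<rfloor>
    + (\<lfloor>real g / 2\<rfloor> - 1 / 2) * \<lfloor>(real g + 2) / 6\<rfloor>
    + \<lfloor>2 * real g / 5\<rfloor> * \<lfloor>(real g + 2) / 5\<rfloor>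
    - \<lfloor>real g / 2\<rfloor> * \<lfloor>(real g + 2) / 4\<rfloor>
    + (real g + 1 / 2) * \<lfloor>(real g + 2) / 3\<rfloor>
    + (- \<lfloor>real g / 2\<rfloor> + real g + 1 / 2) * \<lfloor>(real g + 5) / 6\<rfloor>
    + (\<lfloor>real g / 5\<rfloor> - real g + 1) * \<lfloor>(2 * real g + 1) / 5\<rfloor>
    + (- \<lfloor>(real g + 1) / 5\<rfloor> + real g + 1) * \<lfloor>(2 * real g + 4) / 5\<rfloor>
    - 5 * real g ^ 2 / 8
    - 3 * real g / 8"
proof -
  have floors:
    "\<lfloor>real g / 2\<rfloor> = int (g div 2)" "\<lfloor>real g / 3\<rfloor> = int (g div 3)"
    "\<lfloor>real g / 4\<rfloor> = int (g div 4)" "\<lfloor>real g / 5\<rfloor> = int (g div 5)"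
    "\<lfloor>2 * real g / 5\<rfloor> = int (2 * g div 5)"
    "\<lfloor>(real g + 1) / 3\<rfloor> = int ((g + 1) div 3)" "\<lfloor>(real g + 1) / 5\<rfloor> = int ((g + 1) div 5)"
    "\<lfloor>(real g + 2) / 3\<rfloor> = int ((g + 2) div 3)" "\<lfloor>(real g + 2) / 4\<rfloor> = int ((g + 2) div 4)"
    "\<lfloor>(real g + 2) / 5\<rfloor> = int ((g + 2) div 5)" "\<lfloor>(real g + 2) / 6\<rfloor> = int ((g + 2) div 6)"
    "\<lfloor>(real g + 5) / 6\<rfloor> = int ((g + 5) div 6)"
    "\<lfloor>(2 * real g + 1) / 5\<rfloor> = int ((2 * g + 1) div 5)"
    "\<lfloor>(2 * real g + 4) / 5\<rfloor> = int ((2 * g + 4) div 5)"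
    by (simp_all add: ac_simps flip: floor_divide_of_nat_eq[where 'a = real])
  have "4 \<le> g" using assms by simp
  \<comment> \<open>With floors turned into natural division, the goal is a linear combination of
    these three equations, products of quotients being treated as atoms.\<close>
  from card_numerical_semigroups_4[OF this] floor_terms_mod_12[of g] floor_terms_mod_5[of g]
  show ?thesis
    unfolding floors of_int_add of_int_diff of_int_mult of_int_minus of_int_power of_int_of_nat_eq of_int_1 of_nat_power
    by linarith
qed

end
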